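(* Let $(X,b,m)$ be a weighted graph satisfying $\inf_{y\sim x}m(y)>0$ for all $x\in X$. Then there exists a function $W\colon X\to\mathbb{R}$ such that $L_c+W$ is essentially self-adjoint.
   Context: A weighted graph $(X,b,m)$ consists of a countably infinite set $X$, a symmetric $b\colon X\times X\to[0,\infty)$ vanishing on the diagonal with $\sum_y b(x,y)<\infty$ for all $x$, and $m\colon X\to(0,\infty)$. Write $x\sim y$ if $b(x,y)>0$. All functions are real-valued; $\ell^2(X,m)$ has inner product $\langle f,g\rangle=\sum_x f(x)g(x)m(x)$. The formal Laplacian is $\Delta f(x)=\frac1{m(x)}\sum_y b(x,y)(f(x)-f(y))$ for $f$ with $\sum_y b(x,y)|f(y)|<\infty$ for all $x$. $C_c(X)$ is the set of finitely supported functions and $L_c=\Delta|_{C_c(X)}$, which under the hypothesis on $m$ maps into $\ell^2(X,m)$ and is a symmetric positive operator. $L_c+W$ is the operator on $\ell^2(X,m)$ with domain $C_c(X)$, where $W$ acts by multiplication $(Wf)(x)=W(x)f(x)$. An operator is essentially self-adjoint if it has a unique self-adjoint extension (equivalently, its closure is self-adjoint). *)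

theory Defs
  imports "HOL-Analysis.Analysis" "HOL-Library.Extended_Real"
begin

(* The vertex set X is the universe of the type 'a. *)
definition weighted_graph :: "('a \<Rightarrow> 'a \<Rightarrow> real) \<Rightarrow> ('a \<Rightarrow> real) \<Rightarrow> bool" where
  "weighted_graph b m \<longleftrightarrow>
     countable (UNIV :: 'a set) \<and> infinite (UNIV :: 'a set) \<and>
     (\<forall>x y. 0 \<le> b x y) \<and> (\<forall>x y. b x y = b y x) \<and> (\<forall>x. b x x = 0) \<and>
     (\<forall>x. (\<lambda>y. b x y) summable_on UNIV) \<and>
     (\<forall>x. 0 < m x)"

definition adjacent :: "('a \<Rightarrow> 'a \<Rightarrow> real) \<Rightarrow> 'a \<Rightarrow> 'a \<Rightarrow> bool" where
  "adjacent b x y \<longleftrightarrow> 0 < b x y"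


subsection \<open>Unbounded operators on the weighted sequence space\<close>

definition l2 :: "('a \<Rightarrow> real) \<Rightarrow> ('a \<Rightarrow> real) set" where
  "l2 m = {f. (\<lambda>x. (f x)\<^sup>2 * m x) summable_on UNIV}"

definition l2_inner :: "('a \<Rightarrow> real) \<Rightarrow> ('a \<Rightarrow> real) \<Rightarrow> ('a \<Rightarrow> real) \<Rightarrow> real" where
  "l2_inner m f g = (\<Sum>\<^sub>\<infinity>x. f x * g x * m x)"

definition l2_norm :: "('a \<Rightarrow> real) \<Rightarrow> ('a \<Rightarrow> real) \<Rightarrow> real" where
  "l2_norm m f = sqrt (l2_inner m f f)"

(* An operator, with domain a subspace of l2 m, is represented by its graph: the domain is
   Domain T, extension of operators is inclusion, and equality of operators is equality
   of graphs. *)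
type_synonym 'a operator = "(('a \<Rightarrow> real) \<times> ('a \<Rightarrow> real)) set"

definition linear_operator :: "('a \<Rightarrow> real) \<Rightarrow> 'a operator \<Rightarrow> bool" where
  "linear_operator m T \<longleftrightarrow>
     T \<subseteq> l2 m \<times> l2 m \<and> single_valued T \<and> ((\<lambda>_. 0), (\<lambda>_. 0)) \<in> T \<and>
     (\<forall>(f, f') \<in> T. \<forall>(g, g') \<in> T. \<forall>r s.
        ((\<lambda>x. r * f x + s * g x), (\<lambda>x. r * f' x + s * g' x)) \<in> T)"

definition densely_defined :: "('a \<Rightarrow> real) \<Rightarrow> 'a operator \<Rightarrow> bool" where
  "densely_defined m T \<longleftrightarrow>
     (\<forall>f \<in> l2 m. \<forall>e > 0. \<exists>g \<in> Domain T. l2_norm m (\<lambda>x. f x - g x) < e)"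

definition adjoint_operator :: "('a \<Rightarrow> real) \<Rightarrow> 'a operator \<Rightarrow> 'a operator" where
  "adjoint_operator m T =
     {(g, h) \<in> l2 m \<times> l2 m. \<forall>(f, f') \<in> T. l2_inner m f' g = l2_inner m f h}"

definition self_adjoint :: "('a \<Rightarrow> real) \<Rightarrow> 'a operator \<Rightarrow> bool" where
  "self_adjoint m T \<longleftrightarrow>
     linear_operator m T \<and> densely_defined m T \<and> adjoint_operator m T = T"

definition essentially_self_adjoint :: "('a \<Rightarrow> real) \<Rightarrow> 'a operator \<Rightarrow> bool" where
  "essentially_self_adjoint m T \<longleftrightarrow>
     linear_operator m T \<and> densely_defined m T \<and> (\<exists>!S. self_adjoint m S \<and> T \<subseteq> S)"


subsection \<open>The Laplacian with a potential\<close>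

definition finitely_supported :: "('a \<Rightarrow> real) set" where
  "finitely_supported = {f. finite {x. f x \<noteq> 0}}"

(* Meaningful for f with b x y * |f y| summable in y for every x, in particular for every
   finitely supported f on a weighted graph. *)
definition laplacian ::
  "('a \<Rightarrow> 'a \<Rightarrow> real) \<Rightarrow> ('a \<Rightarrow> real) \<Rightarrow> ('a \<Rightarrow> real) \<Rightarrow> ('a \<Rightarrow> real)" where
  "laplacian b m f x = 1 / m x * (\<Sum>\<^sub>\<infinity>y. b x y * (f x - f y))"

(* Membership of the values in l2 m is not built in here: it is part of linear_operator. *)
definition laplacian_c_plus ::
  "('a \<Rightarrow> 'a \<Rightarrow> real) \<Rightarrow> ('a \<Rightarrow> real) \<Rightarrow> ('a \<Rightarrow> real) \<Rightarrow> 'a operator" where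
  "laplacian_c_plus b m W =
     {(f, (\<lambda>x. laplacian b m f x + W x * f x)) | f. f \<in> finitely_supported}"

end

theory Submission
  imports Defs
begin

text \<open>
  Write $T = L_c + W$. If $T^*$ is symmetric, then it is the unique self-adjoint extension of $T$,
  because every self-adjoint extension $S$ satisfies $S \subseteq T^* \subseteq T^{**} \subseteq S$.
  Elements $(g, h)$ of $T^*$ satisfy $h = \Delta g + W g$, that is, $V g = h + A g$ with
  $V = W + \sum_y b(\cdot, y) / m$ and $A g(x) = \frac{1}{m(x)} \sum_y b(x, y) g(y)$. The values
  $h(x)$ and $A g(x)$ are bounded by constants that depend on $x$ and on the norms of $g$ and $h$,
  but not on $W$; for $A g(x)$ this is where the hypothesis on $m$ enters. A large $V$ therefore
  forces $g$ to decay as fast as desired, so fast that the double sum in Green's formula converges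
  absolutely for any two elements of the domain of $T^*$.
\<close>

section \<open>Square summable functions\<close>

lemma summable_on_real_bounded:
  fixes f g :: "'b \<Rightarrow> real"
  assumes "g summable_on A" and "\<And>x. x \<in> A \<Longrightarrow> \<bar>f x\<bar> \<le> g x"
  shows "f summable_on A"
proof -
  have "(\<lambda>x. norm (f x)) summable_on A"
    by (rule Infinite_Sum.abs_summable_on_comparison_test'[OF assms(1)]) (simp add: assms(2))
  then show ?thesis
    by (subst summable_on_iff_abs_summable_on_real)
qed

lemma summable_on_minus:
  fixes f g :: "'b \<Rightarrow> real"
  assumes "f summable_on A" and "g summable_on A"
  shows "(\<lambda>x. f x - g x) summable_on A"
  using summable_on_add[OF assms(1), of "\<lambda>x. - g x"] assms(2) by (simp add: summable_on_uminus)

lemma infsum_minus: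
  fixes f g :: "'b \<Rightarrow> real"
  assumes "f summable_on A" and "g summable_on A"
  shows "infsum (\<lambda>x. f x - g x) A = infsum f A - infsum g A"
  using infsum_add[OF assms(1), of "\<lambda>x. - g x"] assms(2)
  by (simp add: summable_on_uminus infsum_uminus)

lemma infsum_abs_le:
  fixes f g :: "'b \<Rightarrow> real"
  assumes g: "g summable_on A" and le: "\<And>x. x \<in> A \<Longrightarrow> \<bar>f x\<bar> \<le> g x"
  shows "\<bar>infsum f A\<bar> \<le> infsum g A"
proof -
  have f: "f summable_on A"
    using summable_on_real_bounded[of g A f] assms by blast
  have "infsum f A \<le> infsum g A"
    using le by (intro infsum_mono f g) (auto intro: order_trans[OF abs_ge_self])
  moreover have "infsum (\<lambda>x. - f x) A \<le> infsum g A"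
    using le by (intro infsum_mono g) (auto simp: f summable_on_uminus intro: order_trans[OF abs_ge_minus_self])
  ultimately show ?thesis
    by (simp add: infsum_uminus)
qed

lemma summable_on_finite_support:
  fixes f g :: "'b \<Rightarrow> real"
  assumes "f \<in> finitely_supported" and "\<And>x. f x = 0 \<Longrightarrow> g x = 0"
  shows "g summable_on A"
  using assms unfolding finitely_supported_def
  by (intro finite_nonzero_values_imp_summable_on) (auto elim: rev_finite_subset)

lemma infsum_delta:
  fixes f :: "'b \<Rightarrow> real"
  assumes "\<And>y. y \<noteq> x \<Longrightarrow> f y = 0"
  shows "infsum f UNIV = f x"
proof -
  have "infsum f UNIV = infsum f {x}"
    using assms by (intro infsum_cong_neutral) auto
  then show ?thesis by simp
qed

text \<open>Weighted Young inequality, from expanding a square. It takes the place of Cauchy-Schwarz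
  below: with \<open>c\<close> equal to the measure at a vertex, it separates a constant of the
  vertex from a squared norm.\<close>

lemma abs_mult_le_sum_squares:
  fixes u v c :: real
  assumes "0 < c"
  shows "\<bar>u * v\<bar> \<le> u\<^sup>2 / c + v\<^sup>2 * c"
proof -
  have "0 \<le> (\<bar>u\<bar> / sqrt c - \<bar>v\<bar> * sqrt c)\<^sup>2" by simp
  also have "\<dots> = u\<^sup>2 / c + v\<^sup>2 * c - 2 * \<bar>u * v\<bar>"
    using assms by (simp add: power2_diff power_divide power_mult_distrib abs_mult)
  finally show ?thesis using abs_ge_zero[of "u * v"] by linarith
qed

text \<open>Test functions in the domain of every operator considered. Pairing with them recovers a
  function pointwise, up to the factor \<open>m x\<close>, and thereby determines the elements of an
  adjoint.\<close>

definition delta :: "'a \<Rightarrow> 'a \<Rightarrow> real" where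
  "delta x y = (if y = x then 1 else 0)"

lemma delta_finitely_supported: "delta x \<in> finitely_supported"
proof -
  have "{y. delta x y \<noteq> 0} \<subseteq> {x}" by (auto simp: delta_def)
  then show ?thesis by (simp add: finitely_supported_def finite_subset)
qed

lemma finitely_supported_lincomb:
  assumes "f \<in> finitely_supported" and "g \<in> finitely_supported"
  shows "(\<lambda>x. r * f x + s * g x) \<in> finitely_supported"
proof -
  have "{x. r * f x + s * g x \<noteq> 0} \<subseteq> {x. f x \<noteq> 0} \<union> {x. g x \<noteq> 0}" by auto
  then show ?thesis
    using assms unfolding finitely_supported_def by (auto intro: finite_subset)
qed

lemma finitely_supported_in_l2: "f \<in> finitely_supported \<Longrightarrow> f \<in> l2 m"
  unfolding l2_def by (auto intro: summable_on_finite_support)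

context
  fixes m :: "'a \<Rightarrow> real"
  assumes m_pos: "\<And>x. 0 < m x"
begin

lemma l2_prod_summable:
  assumes "f \<in> l2 m" and "g \<in> l2 m"
  shows "(\<lambda>x. f x * g x * m x) summable_on UNIV"
proof (rule summable_on_real_bounded)
  show "(\<lambda>x. (f x)\<^sup>2 * m x + (g x)\<^sup>2 * m x) summable_on UNIV"
    using assms by (intro summable_on_add) (auto simp: l2_def)
  fix x
  have "\<bar>f x * g x\<bar> \<le> (f x)\<^sup>2 + (g x)\<^sup>2"
    using abs_mult_le_sum_squares[of 1] by simp
  then have "\<bar>f x * g x\<bar> * m x \<le> ((f x)\<^sup>2 + (g x)\<^sup>2) * m x"
    by (intro mult_right_mono) (auto intro: less_imp_le m_pos)
  then show "\<bar>f x * g x * m x\<bar> \<le> (f x)\<^sup>2 * m x + (g x)\<^sup>2 * m x"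
    using m_pos[of x] by (simp add: abs_mult ring_distribs)
qed

lemma l2_lincomb:
  assumes f: "f \<in> l2 m" and g: "g \<in> l2 m"
  shows "(\<lambda>x. r * f x + s * g x) \<in> l2 m"
proof -
  have "(\<lambda>x. r\<^sup>2 * ((f x)\<^sup>2 * m x) + (2 * r * s) * (f x * g x * m x) + s\<^sup>2 * ((g x)\<^sup>2 * m x))
      summable_on UNIV"
    using f g l2_prod_summable[OF f g]
    by (intro summable_on_add summable_on_cmult_right) (auto simp: l2_def)
  moreover have "(r * f x + s * g x)\<^sup>2 * m x =
      r\<^sup>2 * ((f x)\<^sup>2 * m x) + (2 * r * s) * (f x * g x * m x) + s\<^sup>2 * ((g x)\<^sup>2 * m x)" for x
    by (simp add: power2_eq_square algebra_simps)
  ultimately show ?thesis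
    by (simp add: l2_def)
qed

lemma l2_sum:
  assumes "finite F" and "\<And>i. i \<in> F \<Longrightarrow> f i \<in> l2 m"
  shows "(\<lambda>x. \<Sum>i\<in>F. f i x) \<in> l2 m"
  using assms
proof (induction F rule: finite_induct)
  case empty
  show ?case by (simp add: l2_def)
next
  case (insert i F)
  then have "(\<lambda>x. 1 * f i x + 1 * (\<Sum>i\<in>F. f i x)) \<in> l2 m"
    by (intro l2_lincomb) auto
  then show ?case using insert.hyps by simp
qed

lemma l2_inner_lincomb_left:
  assumes "f \<in> l2 m" and "g \<in> l2 m" and "h \<in> l2 m"
  shows "l2_inner m (\<lambda>x. r * f x + s * g x) h = r * l2_inner m f h + s * l2_inner m g h"
proof -
  have "l2_inner m (\<lambda>x. r * f x + s * g x) h =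
      (\<Sum>\<^sub>\<infinity>x. r * (f x * h x * m x) + s * (g x * h x * m x))"
    unfolding l2_inner_def by (intro infsum_cong) (simp add: algebra_simps)
  also have "\<dots> = (\<Sum>\<^sub>\<infinity>x. r * (f x * h x * m x)) + (\<Sum>\<^sub>\<infinity>x. s * (g x * h x * m x))"
    using assms by (intro infsum_add summable_on_cmult_right l2_prod_summable)
  finally show ?thesis
    by (simp add: l2_inner_def infsum_cmult_right')
qed

lemma l2_inner_commute: "l2_inner m f g = l2_inner m g f"
  by (simp add: l2_inner_def mult.commute)

lemma l2_inner_lincomb_right:
  assumes "f \<in> l2 m" and "g \<in> l2 m" and "h \<in> l2 m"
  shows "l2_inner m h (\<lambda>x. r * f x + s * g x) = r * l2_inner m h f + s * l2_inner m h g"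
  using l2_inner_lincomb_left[OF assms] by (simp add: l2_inner_commute[of h])

lemma l2_inner_delta: "l2_inner m (delta x) h = h x * m x"
  unfolding l2_inner_def by (subst infsum_delta[of x]) (auto simp: delta_def)

text \<open>A single term of a nonnegative sum is at most the whole sum, so
  \<open>(h x)^2 * m x\<close> is at most the squared norm; Young's inequality with
  \<open>c = m x\<close> removes the square.\<close>

lemma l2_value_bound:
  assumes "h \<in> l2 m"
  shows "\<bar>h x\<bar> \<le> 1 / m x + l2_inner m h h"
proof -
  have "(\<Sum>y\<in>{x}. (h y)\<^sup>2 * m y) \<le> (\<Sum>\<^sub>\<infinity>y. (h y)\<^sup>2 * m y)"
    using assms m_pos by (intro finite_sum_le_infsum) (auto simp: l2_def less_imp_le)
  then have "(h x)\<^sup>2 * m x \<le> l2_inner m h h"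
    by (simp add: l2_inner_def power2_eq_square)
  then show ?thesis
    using abs_mult_le_sum_squares[OF m_pos[of x], of 1 "h x"] by simp
qed

lemma l2_inner_self_nonneg: "0 \<le> l2_inner m h h"
  unfolding l2_inner_def using m_pos by (intro infsum_nonneg) (simp add: less_imp_le)


section \<open>Self-adjoint extensions\<close>

lemma finitely_supported_dense:
  assumes "finitely_supported \<subseteq> Domain T"
  shows "densely_defined m T"
  unfolding densely_defined_def
proof (intro ballI allI impI)
  fix f and e :: real
  assume f: "f \<in> l2 m" and e: "0 < e"
  let ?F = "\<lambda>x. (f x)\<^sup>2 * m x"
  have s: "?F summable_on UNIV" using f by (simp add: l2_def)
  \<comment> \<open>Half of the square of \<open>e\<close>, because the finite approximation gives a
    non-strict bound and the norm has to be strictly below \<open>e\<close>.\<close>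
  have "0 < e\<^sup>2 / 2" using e by simp
  from infsum_finite_approximation[OF s this] obtain A where A: "finite A"
    and d: "dist (sum ?F A) (infsum ?F UNIV) \<le> e\<^sup>2 / 2"
    by auto
  define g where "g x = (if x \<in> A then f x else 0)" for x
  have "{x. g x \<noteq> 0} \<subseteq> A" by (auto simp: g_def)
  then have g: "g \<in> finitely_supported"
    using A by (auto simp: finitely_supported_def intro: finite_subset)
  have "l2_inner m (\<lambda>x. f x - g x) (\<lambda>x. f x - g x) = infsum ?F (UNIV - A)"
    unfolding l2_inner_def by (intro infsum_cong_neutral) (auto simp: g_def power2_eq_square)
  also have "\<dots> = infsum ?F UNIV - sum ?F A"
    using s A by (subst infsum_Diff) auto
  also have "\<dots> < e\<^sup>2"
    using d \<open>0 < e\<^sup>2 / 2\<close> by (simp only: dist_real_def)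
  finally have "l2_norm m (\<lambda>x. f x - g x) < e"
    unfolding l2_norm_def using e by (intro real_less_lsqrt) auto
  then show "\<exists>g\<in>Domain T. l2_norm m (\<lambda>x. f x - g x) < e"
    using g assms by blast
qed

lemma adjoint_operator_antimono: "S \<subseteq> T \<Longrightarrow> adjoint_operator m T \<subseteq> adjoint_operator m S"
  unfolding adjoint_operator_def by fast

lemma adjoint_operator_iff:
  "(g, h) \<in> adjoint_operator m T \<longleftrightarrow> g \<in> l2 m \<and> h \<in> l2 m \<and>
     (\<forall>f f'. (f, f') \<in> T \<longrightarrow> l2_inner m f' g = l2_inner m f h)"
  unfolding adjoint_operator_def by auto

text \<open>The conditions defining the adjoint are linear in the pair \<open>(g, h)\<close>.
  Single-valuedness comes from the delta functions in the domain of \<open>T\<close>: pairing with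
  them fixes \<open>h\<close> at every vertex.\<close>

lemma linear_operator_adjoint:
  assumes T: "T \<subseteq> l2 m \<times> l2 m" and dom: "finitely_supported \<subseteq> Domain T"
  shows "linear_operator m (adjoint_operator m T)"
  unfolding linear_operator_def
proof (intro conjI)
  show "adjoint_operator m T \<subseteq> l2 m \<times> l2 m"
    by (auto simp: adjoint_operator_def)
  show "single_valued (adjoint_operator m T)"
  proof (rule single_valuedI)
    fix g h h'
    assume a: "(g, h) \<in> adjoint_operator m T" "(g, h') \<in> adjoint_operator m T"
    show "h = h'"
    proof
      fix x
      obtain d where d: "(delta x, d) \<in> T"
        using subsetD[OF dom delta_finitely_supported] by (rule DomainE)
      have "l2_inner m d g = l2_inner m (delta x) h" "l2_inner m d g = l2_inner m (delta x) h'"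
        using a d unfolding adjoint_operator_iff by blast+
      then show "h x = h' x"
        using m_pos[of x] by (simp add: l2_inner_delta)
    qed
  qed
  show "((\<lambda>_. 0), (\<lambda>_. 0)) \<in> adjoint_operator m T"
    by (simp add: adjoint_operator_iff l2_def l2_inner_def)
  show "\<forall>(f, f')\<in>adjoint_operator m T. \<forall>(g, g')\<in>adjoint_operator m T. \<forall>r s.
      ((\<lambda>x. r * f x + s * g x), (\<lambda>x. r * f' x + s * g' x)) \<in> adjoint_operator m T"
  proof (clarify, unfold adjoint_operator_iff, intro conjI allI impI)
    fix f f' g g' r s
    assume f: "f \<in> l2 m \<and> f' \<in> l2 m \<and> (\<forall>u u'. (u, u') \<in> T \<longrightarrow> l2_inner m u' f = l2_inner m u f')"
      and g: "g \<in> l2 m \<and> g' \<in> l2 m \<and> (\<forall>u u'. (u, u') \<in> T \<longrightarrow> l2_inner m u' g = l2_inner m u g')"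
    show "(\<lambda>x. r * f x + s * g x) \<in> l2 m" "(\<lambda>x. r * f' x + s * g' x) \<in> l2 m"
      using f g by (simp_all add: l2_lincomb)
    fix u u'
    assume u: "(u, u') \<in> T"
    with T have "u \<in> l2 m" "u' \<in> l2 m" by auto
    with f g u show "l2_inner m u' (\<lambda>x. r * f x + s * g x) = l2_inner m u (\<lambda>x. r * f' x + s * g' x)"
      by (simp add: l2_inner_lincomb_right)
  qed
qed

text \<open>No closure of \<open>T\<close> is formed: the adjoint itself is the extension. Taking
  adjoints reverses inclusions, so \<open>sym\<close> puts the second adjoint inside the first, and
  \<open>adj_sym\<close> gives the opposite inclusion.\<close>

lemma essentially_self_adjointI:
  assumes lin: "linear_operator m T"
    and dom: "finitely_supported \<subseteq> Domain T"
    and sym: "T \<subseteq> adjoint_operator m T"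
    and adj_sym: "adjoint_operator m T \<subseteq> adjoint_operator m (adjoint_operator m T)"
  shows "essentially_self_adjoint m T"
  unfolding essentially_self_adjoint_def
proof (intro conjI lin finitely_supported_dense dom ex1I[of _ "adjoint_operator m T"])
  show "self_adjoint m (adjoint_operator m T)"
    unfolding self_adjoint_def
  proof (intro conjI)
    show "linear_operator m (adjoint_operator m T)"
      using lin dom by (intro linear_operator_adjoint) (auto simp: linear_operator_def)
    show "densely_defined m (adjoint_operator m T)"
      using dom sym by (intro finitely_supported_dense) blast
    show "adjoint_operator m (adjoint_operator m T) = adjoint_operator m T"
      using adjoint_operator_antimono[OF sym] adj_sym by blast
  qed
  show "T \<subseteq> adjoint_operator m T" by (rule sym)
  fix S
  assume S: "self_adjoint m S \<and> T \<subseteq> S"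
  then have SS: "adjoint_operator m S = S" by (simp add: self_adjoint_def)
  from S adjoint_operator_antimono[of T S] SS have "S \<subseteq> adjoint_operator m T" by simp
  with adjoint_operator_antimono[OF this] SS adj_sym show "S = adjoint_operator m T" by blast
qed

end


section \<open>Green's formula\<close>

context
  fixes b :: "'a \<Rightarrow> 'a \<Rightarrow> real" and m :: "'a \<Rightarrow> real"
  assumes graph: "weighted_graph b m"
begin

lemma graph_m_pos: "0 < m x"
  and graph_nonneg: "0 \<le> b x y"
  and graph_sym: "b x y = b y x"
  and graph_summable: "b x summable_on UNIV"
  using graph by (auto simp: weighted_graph_def)

text \<open>Splitting the sum of differences needs both parts to be summable, because
  \<open>infsum\<close> is 0 on a non-summable family. The factor \<open>m x\<close> on the left
  avoids a division.\<close>

lemma laplacian_eq: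
  assumes "(\<lambda>y. b x y * f y) summable_on UNIV"
  shows "laplacian b m f x * m x = infsum (b x) UNIV * f x - (\<Sum>\<^sub>\<infinity>y. b x y * f y)"
proof -
  have "laplacian b m f x * m x = (\<Sum>\<^sub>\<infinity>y. b x y * (f x - f y))"
    using graph_m_pos[of x] by (simp add: laplacian_def)
  also have "\<dots> = (\<Sum>\<^sub>\<infinity>y. b x y * f x - b x y * f y)"
    by (simp add: algebra_simps)
  also have "\<dots> = (\<Sum>\<^sub>\<infinity>y. b x y * f x) - (\<Sum>\<^sub>\<infinity>y. b x y * f y)"
    by (intro infsum_minus assms summable_on_cmult_left graph_summable)
  finally show ?thesis by (simp add: infsum_cmult_left')
qed

text \<open>At each vertex the two integrands share the degree and potential terms and differ only
  by \<open>?P x - ?Q x\<close>. The shared terms are never summed on their own, only inside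
  \<open>?L\<close>, which \<open>inner\<close> controls. The sums of \<open>?P\<close> and
  \<open>?Q\<close> agree by Fubini, for which \<open>double\<close> is assumed.\<close>

lemma green_formula:
  assumes f: "\<And>x. (\<lambda>y. b x y * f y) summable_on UNIV"
    and g: "\<And>x. (\<lambda>y. b x y * g y) summable_on UNIV"
    and double: "(\<lambda>(x, y). b x y * f x * g y) summable_on UNIV \<times> UNIV"
    and inner: "(\<lambda>x. (laplacian b m f x + W x * f x) * g x * m x) summable_on UNIV"
  shows "l2_inner m (\<lambda>x. laplacian b m f x + W x * f x) g =
    l2_inner m f (\<lambda>x. laplacian b m g x + W x * g x)"
proof -
  let ?P = "\<lambda>x. \<Sum>\<^sub>\<infinity>y. b x y * f x * g y" and ?Q = "\<lambda>x. \<Sum>\<^sub>\<infinity>y. b y x * f y * g x"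
  let ?L = "\<lambda>x. (laplacian b m f x + W x * f x) * g x * m x"
  have double': "(\<lambda>(x, y). b y x * f y * g x) summable_on UNIV \<times> UNIV"
    using double by (subst summable_on_swap) simp
  have P: "?P summable_on UNIV" and Q: "?Q summable_on UNIV"
    using summable_on_Sigma_banach[OF double] summable_on_Sigma_banach[OF double'] by simp_all
  have PQ: "infsum ?P UNIV = infsum ?Q UNIV"
    by (rule infsum_swap_banach[OF double])
  have eq: "f x * (laplacian b m g x + W x * g x) * m x = ?L x - (?P x - ?Q x)" for x
  proof -
    have "?P x = f x * (\<Sum>\<^sub>\<infinity>y. b x y * g y)"
      by (subst infsum_cmult_right'[symmetric]) (simp add: ac_simps)
    moreover have "?Q x = g x * (\<Sum>\<^sub>\<infinity>y. b x y * f y)"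
      by (subst infsum_cmult_right'[symmetric]) (simp add: graph_sym[of _ x] ac_simps)
    moreover have "f x * (laplacian b m g x + W x * g x) * m x =
        f x * (laplacian b m g x * m x) + W x * f x * g x * m x"
      by (simp add: algebra_simps)
    moreover have "?L x = g x * (laplacian b m f x * m x) + W x * f x * g x * m x"
      by (simp add: algebra_simps)
    ultimately show ?thesis
      by (simp only: laplacian_eq[OF f] laplacian_eq[OF g]) (simp add: algebra_simps)
  qed
  have "l2_inner m f (\<lambda>x. laplacian b m g x + W x * g x) = infsum ?L UNIV - (infsum ?P UNIV - infsum ?Q UNIV)"
    unfolding l2_inner_def eq
    using inner P Q by (simp add: infsum_minus summable_on_minus)
  with PQ show ?thesis by (simp add: l2_inner_def)
qed

text \<open>Tonelli: the iterated sum of absolute values converges, so the nonnegative family is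
  summable over pairs and dominates the signed one.\<close>

lemma summable_double:
  assumes g: "\<And>x. (\<lambda>y. b x y * g y) summable_on UNIV"
    and f: "(\<lambda>x. \<bar>f x\<bar> * (\<Sum>\<^sub>\<infinity>y. b x y * \<bar>g y\<bar>)) summable_on UNIV"
  shows "(\<lambda>(x, y). b x y * f x * g y) summable_on UNIV \<times> UNIV"
proof -
  have abs: "(\<lambda>y. b x y * \<bar>g y\<bar>) summable_on UNIV" for x
    using g[of x] graph_nonneg
    by (simp add: summable_on_iff_abs_summable_on_real[of "\<lambda>y. b x y * g y"] abs_mult)
  have "(\<lambda>(x, y). \<bar>f x\<bar> * (b x y * \<bar>g y\<bar>)) summable_on UNIV \<times> UNIV"
  proof (rule summable_on_SigmaI)
    show "((\<lambda>y. case (x, y) of (x, y) \<Rightarrow> \<bar>f x\<bar> * (b x y * \<bar>g y\<bar>)) has_sum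
        \<bar>f x\<bar> * (\<Sum>\<^sub>\<infinity>y. b x y * \<bar>g y\<bar>)) UNIV" for x
      using has_sum_cmult_right[OF has_sum_infsum[OF abs[of x]]] by simp
  qed (use f graph_nonneg in auto)
  then show ?thesis
    by (rule summable_on_real_bounded) (auto simp: abs_mult graph_nonneg)
qed


section \<open>The Laplacian with a large potential\<close>

context
  assumes inf_pos: "\<forall>x. 0 < (INF y \<in> {y. adjacent b x y}. ereal (m y))"
begin

text \<open>The sum is the squared norm of \<open>b x y / m y\<close> as a function of
  \<open>y\<close>. It is dominated by a multiple of \<open>b x y\<close>, since
  \<open>b x y\<close> is at most the total weight at \<open>x\<close> and \<open>m\<close> is
  bounded below on the neighbours of \<open>x\<close>. The infimum hypothesis enters through this
  lemma alone.\<close>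

lemma summable_square_weights: "(\<lambda>y. (b x y)\<^sup>2 / m y) summable_on UNIV"
proof -
  \<comment> \<open>A real \<open>c\<close> strictly below the infimum also handles a vertex without
    neighbours, where the infimum is infinite.\<close>
  obtain c where c: "0 < c" and lt: "ereal c < (INF y \<in> {y. adjacent b x y}. ereal (m y))"
    using ereal_dense2[OF inf_pos[rule_format, of x]] by auto
  have cm: "c \<le> m y" if "0 < b x y" for y
  proof -
    have "ereal c < ereal (m y)"
      by (rule less_INF_D[OF lt]) (simp add: adjacent_def that)
    then show ?thesis by simp
  qed
  let ?B = "infsum (b x) UNIV"
  have s: "(\<lambda>y. ?B / c * b x y) summable_on UNIV"
    by (intro summable_on_cmult_right graph_summable)
  have le: "\<bar>(b x y)\<^sup>2 / m y\<bar> \<le> ?B / c * b x y" for y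
  \<comment> \<open>The bound \<open>c\<close> holds only at neighbours of \<open>x\<close>; at all
    other vertices both sides vanish.\<close>
  proof (cases "b x y = 0")
    case False
    have bB: "b x y \<le> ?B"
      using finite_sum_le_infsum[OF graph_summable, of "{y}" x] graph_nonneg by simp
    from False have "0 < b x y" using graph_nonneg[of x y] by simp
    then have "b x y / m y * b x y \<le> ?B / c * b x y"
      using bB cm c by (intro mult_right_mono frac_le) auto
    then show ?thesis using graph_m_pos[of y] by (simp add: power2_eq_square)
  qed simp
  show ?thesis
    by (rule summable_on_real_bounded[OF s le])
qed

text \<open>Young's inequality with \<open>c = m y\<close>, summed over \<open>y\<close>. The bound
  splits into a constant of the vertex \<open>x\<close> and a squared norm of
  \<open>g\<close>.\<close>

lemma l2_weighted_summable:
  assumes "g \<in> l2 m"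
  shows "(\<lambda>y. b x y * g y) summable_on UNIV"
    and "(\<Sum>\<^sub>\<infinity>y. b x y * \<bar>g y\<bar>) \<le> (\<Sum>\<^sub>\<infinity>y. (b x y)\<^sup>2 / m y) + l2_inner m g g"
proof -
  have g: "(\<lambda>y. (g y)\<^sup>2 * m y) summable_on UNIV" using assms by (simp add: l2_def)
  have s: "(\<lambda>y. (b x y)\<^sup>2 / m y + (g y)\<^sup>2 * m y) summable_on UNIV"
    by (intro summable_on_add summable_square_weights g)
  have le: "\<bar>b x y * g y\<bar> \<le> (b x y)\<^sup>2 / m y + (g y)\<^sup>2 * m y" for y
    by (rule abs_mult_le_sum_squares[OF graph_m_pos])
  show "(\<lambda>y. b x y * g y) summable_on UNIV"
    by (rule summable_on_real_bounded[OF s le])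
  have "(\<Sum>\<^sub>\<infinity>y. b x y * \<bar>g y\<bar>) \<le> (\<Sum>\<^sub>\<infinity>y. (b x y)\<^sup>2 / m y + (g y)\<^sup>2 * m y)"
    using infsum_abs_le[OF s, of "\<lambda>y. b x y * \<bar>g y\<bar>"] le by (simp add: abs_mult)
  also have "\<dots> = (\<Sum>\<^sub>\<infinity>y. (b x y)\<^sup>2 / m y) + l2_inner m g g"
    by (subst infsum_add[OF summable_square_weights g]) (simp add: l2_inner_def power2_eq_square)
  finally show "(\<Sum>\<^sub>\<infinity>y. b x y * \<bar>g y\<bar>) \<le> (\<Sum>\<^sub>\<infinity>y. (b x y)\<^sup>2 / m y) + l2_inner m g g" .
qed

text \<open>The diagonal part, with degree and potential, has finite support. The rest is a finite
  combination of the columns \<open>b x y / m x\<close> in \<open>x\<close>, which are square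
  summable by \<open>summable_square_weights\<close> and the symmetry of \<open>b\<close>.\<close>

lemma laplacian_finitely_supported_in_l2:
  assumes f: "f \<in> finitely_supported"
  shows "(\<lambda>x. laplacian b m f x + W x * f x) \<in> l2 m"
proof -
  define F where "F = {y. f y \<noteq> 0}"
  have F: "finite F" using f by (simp add: F_def finitely_supported_def)
  have col: "(\<lambda>x. b x y / m x) \<in> l2 m" for y
  proof -
    have "(\<lambda>x. (b x y / m x)\<^sup>2 * m x) = (\<lambda>x. (b y x)\<^sup>2 / m x)"
      using graph_m_pos by (auto simp: fun_eq_iff power2_eq_square graph_sym[of y] less_imp_neq[symmetric])
    then show ?thesis using summable_square_weights[of y] by (simp add: l2_def)
  qed
  \<comment> \<open>The zero term only brings each summand into the form of
    \<open>l2_lincomb\<close>.\<close>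
  have "(\<lambda>x. \<Sum>y\<in>F. f y * (b x y / m x) + 0 * (b x y / m x)) \<in> l2 m"
    using F graph_m_pos col by (intro l2_sum l2_lincomb)
  moreover have "(\<lambda>x. (infsum (b x) UNIV / m x + W x) * f x) \<in> l2 m"
    using f by (intro finitely_supported_in_l2)
      (auto simp: finitely_supported_def elim: rev_finite_subset)
  ultimately have "(\<lambda>x. 1 * ((infsum (b x) UNIV / m x + W x) * f x)
      + (-1) * (\<Sum>y\<in>F. f y * (b x y / m x) + 0 * (b x y / m x))) \<in> l2 m"
    using graph_m_pos by (intro l2_lincomb)
  moreover have "laplacian b m f x + W x * f x = 1 * ((infsum (b x) UNIV / m x + W x) * f x)
      + (-1) * (\<Sum>y\<in>F. f y * (b x y / m x) + 0 * (b x y / m x))" for x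
  proof -
    have "(\<Sum>\<^sub>\<infinity>y. b x y * f y) = infsum (\<lambda>y. b x y * f y) F"
      by (intro infsum_cong_neutral) (auto simp: F_def)
    also have "\<dots> = (\<Sum>y\<in>F. b x y * f y)" using F by simp
    finally have "laplacian b m f x * m x = infsum (b x) UNIV * f x - (\<Sum>y\<in>F. b x y * f y)"
      by (simp add: laplacian_eq[OF summable_on_finite_support[OF f]])
    moreover have "(\<Sum>y\<in>F. f y * (b x y / m x)) = (\<Sum>y\<in>F. b x y * f y) / m x"
      by (simp add: sum_divide_distrib mult.commute)
    ultimately show ?thesis
      using graph_m_pos[of x] by (simp add: field_simps)
  qed
  ultimately show ?thesis by simp
qed

section \<open>The operator L_c + W and its adjoint\<close>

lemma laplacian_c_plus_iff:
  "(f, f') \<in> laplacian_c_plus b m W \<longleftrightarrow>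
     f \<in> finitely_supported \<and> f' = (\<lambda>x. laplacian b m f x + W x * f x)"
  by (auto simp: laplacian_c_plus_def)

lemma laplacian_c_plus_dom: "finitely_supported \<subseteq> Domain (laplacian_c_plus b m W)"
  by (auto simp: laplacian_c_plus_def)

lemma linear_operator_laplacian_c_plus: "linear_operator m (laplacian_c_plus b m W)"
proof -
  have add: "laplacian b m (\<lambda>x. r * f x + s * g x) x = r * laplacian b m f x + s * laplacian b m g x"
    if f: "f \<in> finitely_supported" and g: "g \<in> finitely_supported" for f g r s x
  proof -
    have "(\<Sum>\<^sub>\<infinity>y. b x y * (r * f y + s * g y)) =
        (\<Sum>\<^sub>\<infinity>y. r * (b x y * f y) + s * (b x y * g y))"
      by (simp add: algebra_simps)
    also have "\<dots> = r * (\<Sum>\<^sub>\<infinity>y. b x y * f y) + s * (\<Sum>\<^sub>\<infinity>y. b x y * g y)"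
      by (subst infsum_add) (auto simp: infsum_cmult_right' intro: summable_on_finite_support f g)
    finally have "laplacian b m (\<lambda>x. r * f x + s * g x) x * m x =
        (r * laplacian b m f x + s * laplacian b m g x) * m x"
      using f g finitely_supported_lincomb[OF f g, of r s]
      by (simp add: ring_distribs mult.assoc laplacian_eq[OF summable_on_finite_support])
    then show ?thesis using graph_m_pos[of x] by simp
  qed
  have zero: "laplacian b m (\<lambda>_. 0) x = 0" for x
    by (simp add: laplacian_def)
  show ?thesis
    unfolding linear_operator_def
  proof (intro conjI)
    show "laplacian_c_plus b m W \<subseteq> l2 m \<times> l2 m"
      by (auto simp: laplacian_c_plus_iff finitely_supported_in_l2 laplacian_finitely_supported_in_l2)
    show "single_valued (laplacian_c_plus b m W)"
      by (auto simp: single_valued_def laplacian_c_plus_iff)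
    show "((\<lambda>_. 0), (\<lambda>_. 0)) \<in> laplacian_c_plus b m W"
      by (simp add: laplacian_c_plus_iff finitely_supported_def zero)
    show "\<forall>(f, f')\<in>laplacian_c_plus b m W. \<forall>(g, g')\<in>laplacian_c_plus b m W. \<forall>r s.
        ((\<lambda>x. r * f x + s * g x), (\<lambda>x. r * f' x + s * g' x)) \<in> laplacian_c_plus b m W"
      by (auto simp: laplacian_c_plus_iff finitely_supported_lincomb add fun_eq_iff algebra_simps)
  qed
qed

text \<open>The outer sum runs over the finite support of \<open>f\<close>, so \<open>g\<close> may
  be any element of \<open>l2 m\<close>. This serves both the symmetry of L_c + W and the
  computation of its adjoint.\<close>

lemma green_formula_finitely_supported:
  assumes f: "f \<in> finitely_supported" and g: "g \<in> l2 m"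
  shows "l2_inner m (\<lambda>x. laplacian b m f x + W x * f x) g =
    l2_inner m f (\<lambda>x. laplacian b m g x + W x * g x)"
proof (rule green_formula)
  show "(\<lambda>y. b x y * f y) summable_on UNIV" for x
    by (rule summable_on_finite_support[OF f]) simp
  show gs: "(\<lambda>y. b x y * g y) summable_on UNIV" for x
    by (rule l2_weighted_summable[OF g])
  show "(\<lambda>(x, y). b x y * f x * g y) summable_on UNIV \<times> UNIV"
    by (intro summable_double gs summable_on_finite_support[OF f]) simp
  show "(\<lambda>x. (laplacian b m f x + W x * f x) * g x * m x) summable_on UNIV"
    using graph_m_pos laplacian_finitely_supported_in_l2[OF f] g by (intro l2_prod_summable)
qed

lemma laplacian_c_plus_symmetric:
  "laplacian_c_plus b m W \<subseteq> adjoint_operator m (laplacian_c_plus b m W)"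
  by (auto simp: laplacian_c_plus_iff adjoint_operator_iff[OF graph_m_pos] finitely_supported_in_l2
      laplacian_finitely_supported_in_l2 green_formula_finitely_supported)

text \<open>Test with \<open>delta x\<close>: Green's formula moves the operator onto
  \<open>g\<close>, and the pairing reads off the value at \<open>x\<close>.\<close>

lemma adjoint_laplacian_c_plus:
  assumes "(g, h) \<in> adjoint_operator m (laplacian_c_plus b m W)"
  shows "h = (\<lambda>x. laplacian b m g x + W x * g x)"
proof
  fix x
  have g: "g \<in> l2 m" using assms by (simp add: adjoint_operator_iff[OF graph_m_pos])
  have "l2_inner m (delta x) h = l2_inner m (\<lambda>z. laplacian b m (delta x) z + W z * delta x z) g"
    using assms
    by (simp add: adjoint_operator_iff[OF graph_m_pos] laplacian_c_plus_iff delta_finitely_supported)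
  also have "\<dots> = l2_inner m (delta x) (\<lambda>x. laplacian b m g x + W x * g x)"
    by (rule green_formula_finitely_supported[OF delta_finitely_supported g])
  finally show "h x = laplacian b m g x + W x * g x"
    using graph_m_pos[of x] by (simp add: l2_inner_delta[OF graph_m_pos])
qed

section \<open>Choice of the potential and decay on the domain of the adjoint\<close>

lemma ex_positive_summable: "\<exists>e :: 'a \<Rightarrow> real. (\<forall>x. 0 < e x) \<and> e summable_on UNIV"
proof (intro exI conjI allI)
  let ?n = "to_nat_on (UNIV :: 'a set)"
  have inj: "inj ?n"
    using graph by (intro inj_on_to_nat_on) (simp add: weighted_graph_def)
  have "(\<lambda>n. (1 / 2 :: real) ^ n) summable_on UNIV"
    by (subst summable_on_UNIV_nonneg_real_iff) (auto intro: summable_geometric)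
  then have "(\<lambda>n. (1 / 2 :: real) ^ n) summable_on range ?n"
    by (rule summable_on_subset_banach) simp
  \<comment> \<open>This instantiates the witness left schematic by \<open>exI\<close>: a geometric
    series pulled back along an enumeration of the vertices. Its positivity is left to the final
    \<open>simp\<close>.\<close>
  then show "(\<lambda>x. (1 / 2 :: real) ^ ?n x) summable_on UNIV"
    by (simp add: summable_on_reindex[OF inj] o_def)
qed simp

lemma ex_potential:
  "\<exists>W. essentially_self_adjoint m (laplacian_c_plus b m W)"
proof -
  obtain e :: "'a \<Rightarrow> real" where e_pos: "\<And>x. 0 < e x" and e_sum: "e summable_on UNIV"
    using ex_positive_summable by blast
  define D where "D x = (\<Sum>\<^sub>\<infinity>y. (b x y)\<^sup>2 / m y)" for x
  have D_nonneg: "0 \<le> D x" for x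
    unfolding D_def using graph_m_pos by (intro infsum_nonneg) (simp add: less_imp_le)
  \<comment> \<open>\<open>1 / m x + 1\<close> will bound the value of \<open>h\<close>, and
    \<open>(1 + D x) / m x\<close> the averaging term of \<open>g\<close>, each up to the common
    factor \<open>1 + ?N g + ?N h\<close>.\<close>
  define K where "K x = 1 / m x + 1 + (1 + D x) / m x" for x
  have K_pos: "0 < K x" for x
    unfolding K_def using graph_m_pos[of x] D_nonneg[of x] by (simp add: add_pos_nonneg)
  \<comment> \<open>Dividing by \<open>V x\<close> cancels \<open>K x\<close> and leaves decay of
    order \<open>e x / (1 + D x)\<close>. The factor \<open>1 + D x\<close> is reserved for the
    growth of the inner sums in Green's formula.\<close>
  define V where "V x = K x * (1 + D x) / e x" for x
  \<comment> \<open>Subtracting the weighted degree cancels the diagonal of the Laplacian, so that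
    \<open>V\<close> is the whole diagonal of the operator.\<close>
  define W where "W x = V x - infsum (b x) UNIV / m x" for x
  let ?T = "laplacian_c_plus b m W"
  let ?N = "\<lambda>f. l2_inner m f f"
  note N_nonneg = l2_inner_self_nonneg[of m, OF graph_m_pos]
  note adj_iff = adjoint_operator_iff[of m, OF graph_m_pos]
  have decay: "\<bar>g x\<bar> * (1 + D x) \<le> e x * (1 + ?N g + ?N h)"
    if gh: "(g, h) \<in> adjoint_operator m ?T" for g h x
  proof -
    have g: "g \<in> l2 m" and h: "h \<in> l2 m" using gh by (auto simp: adj_iff)
    note gs = l2_weighted_summable[OF g, of x]
    let ?A = "\<Sum>\<^sub>\<infinity>y. b x y * g y"
    have "h x * m x = laplacian b m g x * m x + W x * g x * m x"
      by (simp add: adjoint_laplacian_c_plus[OF gh] ring_distribs)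
    also have "\<dots> = V x * g x * m x - ?A"
    proof -
      have "W x * m x = V x * m x - infsum (b x) UNIV"
        using graph_m_pos[of x] by (simp add: W_def left_diff_distrib)
      then have "W x * g x * m x = V x * g x * m x - infsum (b x) UNIV * g x"
        by (metis (no_types, lifting) left_diff_distrib mult.assoc mult.commute)
      then show ?thesis by (simp add: laplacian_eq[OF gs(1)])
    qed
    finally have Vg: "V x * g x = h x + ?A / m x"
      using graph_m_pos[of x] by (simp add: field_simps)
    have "\<bar>?A\<bar> \<le> (\<Sum>\<^sub>\<infinity>y. b x y * \<bar>g y\<bar>)"
      using gs(1) graph_nonneg
      by (intro infsum_abs_le)
        (auto simp: abs_mult summable_on_iff_abs_summable_on_real[of "\<lambda>y. b x y * g y"])
    also have "\<dots> \<le> D x + ?N g"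
      using gs(2) by (simp add: D_def)
    \<comment> \<open>Turning the sum into a product separates the dependence on \<open>x\<close>,
      which \<open>V\<close> can absorb, from the dependence on \<open>g\<close> and
      \<open>h\<close>.\<close>
    also have "\<dots> \<le> (1 + D x) * (1 + ?N g + ?N h)"
      using D_nonneg[of x] N_nonneg[of g] N_nonneg[of h] by (simp add: algebra_simps)
    finally have A: "\<bar>?A / m x\<bar> \<le> (1 + D x) / m x * (1 + ?N g + ?N h)"
      using graph_m_pos[of x] by (simp add: divide_right_mono)
    have "\<bar>h x\<bar> \<le> 1 / m x + ?N h"
      by (rule l2_value_bound[OF graph_m_pos h])
    also have "\<dots> \<le> (1 / m x + 1) * (1 + ?N g + ?N h)"
    proof -
      have "0 \<le> 1 / m x * (?N g + ?N h)"
        using graph_m_pos[of x] N_nonneg[of g] N_nonneg[of h] by simp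
      then show ?thesis
        using N_nonneg[of g] by (simp add: algebra_simps)
    qed
    finally have "\<bar>V x * g x\<bar> \<le> K x * (1 + ?N g + ?N h)"
      unfolding Vg K_def using A by (simp only: ring_distribs)
    then have "K x * (\<bar>g x\<bar> * (1 + D x)) \<le> K x * (e x * (1 + ?N g + ?N h))"
      using K_pos[of x] e_pos[of x] D_nonneg[of x] by (simp add: V_def abs_mult field_simps)
    then show ?thesis using K_pos[of x] by simp
  qed
  have "adjoint_operator m ?T \<subseteq> adjoint_operator m (adjoint_operator m ?T)"
  proof (rule subrelI)
    fix g h
    assume gh: "(g, h) \<in> adjoint_operator m ?T"
    then have g: "g \<in> l2 m" and h: "h \<in> l2 m" by (auto simp: adj_iff)
    have "l2_inner m f' g = l2_inner m f h" if ff: "(f, f') \<in> adjoint_operator m ?T" for f f'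
    proof -
      have f: "f \<in> l2 m" and f': "f' \<in> l2 m" using ff by (auto simp: adj_iff)
      note f'_eq = adjoint_laplacian_c_plus[OF ff]
      \<comment> \<open>The inner sum is at most \<open>D x + ?N g\<close>, hence at most
        \<open>(1 + D x) * (1 + ?N g)\<close>. The decay of \<open>f\<close> absorbs
        \<open>1 + D x\<close> and leaves a constant multiple of the summable
        \<open>e x\<close>.\<close>
      have bound: "\<bar>\<bar>f x\<bar> * (\<Sum>\<^sub>\<infinity>y. b x y * \<bar>g y\<bar>)\<bar> \<le> (1 + ?N f + ?N f') * (1 + ?N g) * e x" for x
      proof -
        have "0 \<le> (\<Sum>\<^sub>\<infinity>y. b x y * \<bar>g y\<bar>)"
          by (intro infsum_nonneg) (simp add: graph_nonneg)
        then have "\<bar>\<bar>f x\<bar> * (\<Sum>\<^sub>\<infinity>y. b x y * \<bar>g y\<bar>)\<bar> = \<bar>f x\<bar> * (\<Sum>\<^sub>\<infinity>y. b x y * \<bar>g y\<bar>)"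
          by (simp add: abs_mult)
        also have "\<dots> \<le> \<bar>f x\<bar> * (D x + ?N g)"
          using l2_weighted_summable(2)[OF g, of x] by (intro mult_left_mono) (auto simp: D_def)
        also have "\<dots> \<le> \<bar>f x\<bar> * ((1 + D x) * (1 + ?N g))"
          using D_nonneg[of x] N_nonneg[of g] by (intro mult_left_mono) (auto simp: algebra_simps)
        also have "\<dots> \<le> (e x * (1 + ?N f + ?N f')) * (1 + ?N g)"
          using mult_right_mono[OF decay[OF ff, of x], of "1 + ?N g"] N_nonneg[of g]
          by (simp add: mult.assoc)
        finally show ?thesis by (simp add: mult_ac)
      qed
      have "l2_inner m (\<lambda>x. laplacian b m f x + W x * f x) g =
          l2_inner m f (\<lambda>x. laplacian b m g x + W x * g x)"
      proof (rule green_formula)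
        show "(\<lambda>(x, y). b x y * f x * g y) summable_on UNIV \<times> UNIV"
          using bound
          by (intro summable_double l2_weighted_summable g
              summable_on_real_bounded[OF summable_on_cmult_right[OF e_sum]])
        \<comment> \<open>The sum of the two terms is \<open>f'\<close>, which is square summable as
          a value of the adjoint; the terms are not estimated separately.\<close>
        show "(\<lambda>x. (laplacian b m f x + W x * f x) * g x * m x) summable_on UNIV"
          using l2_prod_summable[OF graph_m_pos f' g] by (simp add: f'_eq)
      qed (intro l2_weighted_summable f g)+
      then show ?thesis
        by (simp add: f'_eq adjoint_laplacian_c_plus[OF gh])
    qed
    with g h show "(g, h) \<in> adjoint_operator m (adjoint_operator m ?T)"
      by (subst adj_iff) blast
  qed
  then have "essentially_self_adjoint m ?T"
    by (intro essentially_self_adjointI graph_m_pos linear_operator_laplacian_c_plus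
        laplacian_c_plus_dom laplacian_c_plus_symmetric)
  then show ?thesis by blast
qed

end

end

theorem proposition4p9:
  fixes b :: "'a \<Rightarrow> 'a \<Rightarrow> real" and m :: "'a \<Rightarrow> real"
  assumes "weighted_graph b m"
    and "\<forall>x. 0 < (INF y \<in> {y. adjacent b x y}. ereal (m y))"
  shows "\<exists>W :: 'a \<Rightarrow> real. essentially_self_adjoint m (laplacian_c_plus b m W)"
  using assms by (rule ex_potential)

end
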